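(* Let $L$ be an inductive modular lattice with least element $0$ and greatest element $1$. Then the following conditions are equivalent: (a) $L$ is pseudocomplemented; (b) $L$ contains no 0-sublattice isomorphic to one of the lattices $M_3$ and $M_{2,3}$; (c) $L$ contains no ternary sequence $(a,b,c)$ of elements satisfying the following three conditions: (i) $0\notin\{a,b,c\}$; (ii) $c\wedge a=c\wedge b=0$; (iii) $c\vee a=c\vee b=a\vee b$.
   Context: Inductive lattice: a lattice $L$ is inductive if for all $a\le b$ in $L$ the quotient sublattice (interval) $[a,b]$ satisfies condition (B): for any chain $\{b_i\}_{i\in I}$ in $[a,b]$ and any $x\in[a,b]$ such that $x\wedge b_i=a$ for all $i\in I$, there holds $x\wedge\bigvee_{i\in I}b_i=a$ (it is understood as part of the condition that the join $\bigvee_{i\in I} b_i$ exists). Pseudocomplemented: an element $a^*\in L$ is a pseudocomplement of $a\in L$ if $a\wedge a^*=0$ and, for all $x\in L$, $a\wedge x=0$ implies $x\le a^*$. The lattice $L$ is pseudocomplemented if each of its elements has a pseudocomplement. 0-sublattice: a sublattice of a lattice with least element $0$ (closed under $\vee$ and $\wedge$) is a 0-sublattice if it contains $0$. $M_3$ is the five-element lattice with a least element, a greatest element and three pairwise incomparable elements strictly between them. $M_{2,3}$ is the seven-element lattice with elements $0,d,c,a,b,e,1'$ whose covering relations are exactly: $0\prec d$, $0\prec c$, $d\prec a$, $d\prec b$, $d\prec e$, $c\prec e$, $a\prec 1'$, $b\prec 1'$, $e\prec 1'$ (so $0$ is its least element, $1'$ its greatest element, and $e=c\vee d$). *)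

theory Defs
  imports Main "HOL-Library.Lub_Glb"
begin

definition modular :: "'a::lattice itself \<Rightarrow> bool" where
  "modular _ \<longleftrightarrow> (\<forall>x y z :: 'a. x \<le> z \<longrightarrow> sup x (inf y z) = inf (sup x y) z)"

text \<open>
  The join of the chain is taken in the interval (\<open>isLub {a..b}\<close>), and its existence is part of the
  condition. The set \<open>C\<close> of values replaces the family, since only the values matter.
\<close>

definition condition_B :: "'a::lattice \<Rightarrow> 'a \<Rightarrow> bool" where
  "condition_B a b \<longleftrightarrow>
     (\<forall>C x. C \<subseteq> {a..b} \<and> Complete_Partial_Order.chain (\<le>) C \<and> x \<in> {a..b} \<and> (\<forall>c\<in>C. inf x c = a) \<longrightarrow>
        (\<exists>s. isLub {a..b} C s \<and> inf x s = a))"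

definition inductive_lattice :: "'a::lattice itself \<Rightarrow> bool" where
  "inductive_lattice _ \<longleftrightarrow> (\<forall>a b :: 'a. a \<le> b \<longrightarrow> condition_B a b)"

definition is_pseudocomplement :: "'a::bounded_lattice_bot \<Rightarrow> 'a \<Rightarrow> bool" where
  "is_pseudocomplement a p \<longleftrightarrow> inf a p = bot \<and> (\<forall>x. inf a x = bot \<longrightarrow> x \<le> p)"

definition pseudocomplemented :: "'a::bounded_lattice_bot itself \<Rightarrow> bool" where
  "pseudocomplemented _ \<longleftrightarrow> (\<forall>a :: 'a. \<exists>p. is_pseudocomplement a p)"

definition zero_sublattice :: "'a::bounded_lattice_bot set \<Rightarrow> bool" where
  "zero_sublattice S \<longleftrightarrow> bot \<in> S \<and> (\<forall>x\<in>S. \<forall>y\<in>S. sup x y \<in> S \<and> inf x y \<in> S)"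

definition isomorphic_to :: "'a::lattice set \<Rightarrow> 'm::lattice itself \<Rightarrow> bool" where
  "isomorphic_to S _ \<longleftrightarrow>
     (\<exists>f :: 'm \<Rightarrow> 'a. bij_betw f UNIV S \<and>
        (\<forall>x y. f (sup x y) = sup (f x) (f y) \<and> f (inf x y) = inf (f x) (f y)))"

datatype M3 = M3_0 | M3_a | M3_b | M3_c | M3_1

instantiation M3 :: lattice
begin

definition less_eq_M3 :: "M3 \<Rightarrow> M3 \<Rightarrow> bool" where
  "(x :: M3) \<le> y \<longleftrightarrow> x = y \<or> x = M3_0 \<or> y = M3_1"

definition less_M3 :: "M3 \<Rightarrow> M3 \<Rightarrow> bool" where
  "(x :: M3) < y \<longleftrightarrow> x \<le> y \<and> x \<noteq> y"

definition sup_M3 :: "M3 \<Rightarrow> M3 \<Rightarrow> M3" where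
  "sup x y = (if x \<le> y then y else if y \<le> x then x else M3_1)"

definition inf_M3 :: "M3 \<Rightarrow> M3 \<Rightarrow> M3" where
  "inf x y = (if x \<le> y then x else if y \<le> x then y else M3_0)"

instance
  by standard (auto simp: less_eq_M3_def less_M3_def sup_M3_def inf_M3_def)

end

datatype M23 = M23_0 | M23_d | M23_c | M23_a | M23_b | M23_e | M23_1

definition M23_covers :: "(M23 \<times> M23) set" where
  "M23_covers = {(M23_0, M23_d), (M23_0, M23_c), (M23_d, M23_a), (M23_d, M23_b), (M23_d, M23_e),
     (M23_c, M23_e), (M23_a, M23_1), (M23_b, M23_1), (M23_e, M23_1)}"

instantiation M23 :: lattice
begin

definition less_eq_M23 :: "M23 \<Rightarrow> M23 \<Rightarrow> bool" where
  "(x :: M23) \<le> y \<longleftrightarrow> (x, y) \<in> M23_covers\<^sup>*"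

definition less_M23 :: "M23 \<Rightarrow> M23 \<Rightarrow> bool" where
  "(x :: M23) < y \<longleftrightarrow> x \<le> y \<and> x \<noteq> y"

definition sup_M23 :: "M23 \<Rightarrow> M23 \<Rightarrow> M23" where
  "sup x y = (if x \<le> y then y else if y \<le> x then x else if {x, y} = {M23_c, M23_d} then M23_e else M23_1)"

definition inf_M23 :: "M23 \<Rightarrow> M23 \<Rightarrow> M23" where
  "inf x y = (if x \<le> y then x else if y \<le> x then y else if M23_c \<in> {x, y} then M23_0 else M23_d)"

lemma less_eq_M23_iff:
  "x \<le> y \<longleftrightarrow> x = y \<or> x = M23_0 \<or> y = M23_1 \<or> (x = M23_d \<and> y \<in> {M23_a, M23_b, M23_e}) \<or>
     (x = M23_c \<and> y = M23_e)" (is "_ \<longleftrightarrow> ?R x y")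
proof
  assume "x \<le> y"
  then have "(x, y) \<in> M23_covers\<^sup>*" by (simp add: less_eq_M23_def)
  then show "?R x y"
    by (induction rule: rtrancl_induct) (auto simp: M23_covers_def)
next
  have step: "u \<le> v" if "(u, v) \<in> M23_covers" for u v
    using that unfolding less_eq_M23_def by (rule r_into_rtrancl)
  have trans: "u \<le> w" if "u \<le> v" "v \<le> w" for u v w :: M23
    using that unfolding less_eq_M23_def by (rule rtrancl_trans)
  have [simp]: "v \<le> v" for v :: M23 by (simp add: less_eq_M23_def)
  have [simp]: "M23_0 \<le> M23_d" "M23_0 \<le> M23_c" "M23_d \<le> M23_a" "M23_d \<le> M23_b" "M23_d \<le> M23_e"
    "M23_c \<le> M23_e" "M23_a \<le> M23_1" "M23_b \<le> M23_1" "M23_e \<le> M23_1"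
    by (rule step, simp add: M23_covers_def)+
  have [simp]: "M23_0 \<le> M23_a" "M23_0 \<le> M23_b" "M23_0 \<le> M23_e" "M23_d \<le> M23_1" "M23_c \<le> M23_1"
    by (rule trans[of _ M23_d], simp, simp)+ (rule trans[of _ M23_e], simp, simp)+
  have [simp]: "M23_0 \<le> M23_1" by (rule trans[of _ M23_d]) simp_all
  assume "?R x y"
  then show "x \<le> y" by (cases x; cases y; simp)
qed

instance
proof
  fix x y z :: M23
  note [simp] = less_eq_M23_iff
  show "(x < y) = (x \<le> y \<and> \<not> y \<le> x)" by (cases x; cases y; simp add: less_M23_def)
  show "x \<le> x" by simp
  show "x \<le> y \<Longrightarrow> y \<le> z \<Longrightarrow> x \<le> z" by (cases x; cases y; cases z; simp)
  show "x \<le> y \<Longrightarrow> y \<le> x \<Longrightarrow> x = y" by (cases x; cases y; simp)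
  show "inf x y \<le> x" by (cases x; cases y; simp add: inf_M23_def)
  show "inf x y \<le> y" by (cases x; cases y; simp add: inf_M23_def)
  show "x \<le> y \<Longrightarrow> x \<le> z \<Longrightarrow> x \<le> inf y z" by (cases x; cases y; cases z; simp add: inf_M23_def)
  show "x \<le> sup x y" by (cases x; cases y; simp add: sup_M23_def doubleton_eq_iff)
  show "y \<le> sup x y" by (cases x; cases y; simp add: sup_M23_def doubleton_eq_iff)
  show "y \<le> x \<Longrightarrow> z \<le> x \<Longrightarrow> sup y z \<le> x"
    by (cases x; cases y; cases z; simp add: sup_M23_def doubleton_eq_iff)
qed

end

lemma M23_covers_iff: "(x, y) \<in> M23_covers \<longleftrightarrow> x < y \<and> \<not> (\<exists>z. x < z \<and> z < y)"
proof -
  have ex: "(\<exists>z. P z) \<longleftrightarrow> P M23_0 \<or> P M23_d \<or> P M23_c \<or> P M23_a \<or> P M23_b \<or> P M23_e \<or> P M23_1" for P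
    by (metis M23.exhaust)
  show ?thesis
    unfolding ex by (cases x; cases y; simp add: M23_covers_def less_M23_def less_eq_M23_iff)
qed

end

theory Submission
  imports Defs
begin

text \<open>
  Everything is read off from the set \<open>A c = {x. c \<sqinter> x = 0}\<close> of elements disjoint from \<open>c\<close>; a
  pseudocomplement of \<open>c\<close> is a greatest element of \<open>A c\<close>.

  A triple \<open>(a, b, c)\<close> as in the third condition shows that \<open>A c\<close> has no greatest element: such an
  element would lie above \<open>a\<close> and \<open>b\<close>, hence above \<open>a \<squnion> b \<ge> c\<close>, and \<open>c\<close> would be disjoint from
  itself. Conversely, if there is no such triple then every \<open>A c\<close> is closed under binary joins:
  when \<open>p\<close> and \<open>q\<close> lie in \<open>A c\<close> but \<open>p \<squnion> q\<close> does not, replacing \<open>c\<close> by the nonzero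
  element \<open>c \<sqinter> (p \<squnion> q)\<close> gives three elements with \<open>c \<le> p \<squnion> q\<close>, and Dedekind's construction of a
  diamond inside the sublattice generated by three elements of a modular lattice produces a triple
  (\<open>disjoint_closed_under_sup\<close>). Inductivity enables Zorn's lemma, which yields a maximal element
  of \<open>A c\<close> (\<open>maximal_disjoint_element\<close>); in a set closed under joins, a maximal element is the
  greatest.

  The equivalence with the forbidden sublattices holds because a triple generates, together with
  \<open>0\<close>, a copy of \<open>M\<^sub>3\<close> if \<open>a \<sqinter> b = 0\<close>, and a copy of \<open>M\<^bsub>2,3\<^esub>\<close> with \<open>d = a \<sqinter> b\<close> otherwise, while
  both lattices visibly contain a triple.
\<close>

definition obstructing_triple :: "'a::bounded_lattice_bot \<Rightarrow> 'a \<Rightarrow> 'a \<Rightarrow> bool" where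
  "obstructing_triple a b c \<longleftrightarrow> bot \<notin> {a, b, c} \<and> (inf c a = bot \<and> inf c b = bot) \<and>
     (sup c a = sup c b \<and> sup c b = sup a b)"

lemma modularD:
  fixes x y z :: "'a::lattice"
  assumes "modular TYPE('a)" "x \<le> z"
  shows "sup x (inf y z) = inf (sup x y) z"
  using assms by (auto simp: modular_def)

section \<open>Obstructing triples and pseudocomplements\<close>

lemma pseudocomplemented_no_triple:
  fixes a b c :: "'a::bounded_lattice_bot"
  assumes "pseudocomplemented TYPE('a)"
  shows "\<not> obstructing_triple a b c"
proof
  assume t: "obstructing_triple a b c"
  obtain p where p: "inf c p = bot" "\<And>x. inf c x = bot \<Longrightarrow> x \<le> p"
    using assms unfolding pseudocomplemented_def is_pseudocomplement_def by blast
  have "sup a b \<le> p" using t p(2) by (simp add: obstructing_triple_def)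
  moreover have "c \<le> sup a b" using t by (metis obstructing_triple_def sup_ge1)
  ultimately have "inf c p = c" by (meson inf.absorb1 order_trans)
  then show False using p(1) t by (simp add: obstructing_triple_def)
qed

text \<open>
  The elements \<open>p \<sqinter> (c \<squnion> q)\<close>, \<open>q \<sqinter> (c \<squnion> p)\<close> and \<open>c\<close> have pairwise the join
  \<open>(c \<squnion> p) \<sqinter> (c \<squnion> q)\<close>, by modularity. This is the diamond that three elements of a modular lattice
  generate, simplified by \<open>c \<le> p \<squnion> q\<close>. If one of the first two elements were \<open>0\<close>, then this join would be
  equal both to \<open>c\<close> and to the other element; as these are disjoint, \<open>c\<close> would be \<open>0\<close>.
\<close>
lemma triple_from_disjoint_pair:
  fixes p q c :: "'a::bounded_lattice"
  assumes m: "modular TYPE('a)" and c: "c \<noteq> bot" "c \<le> sup p q"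
    and p: "inf c p = bot" and q: "inf c q = bot"
  shows "obstructing_triple (inf p (sup c q)) (inf q (sup c p)) c"
proof -
  define p' where "p' = inf p (sup c q)"
  define q' where "q' = inf q (sup c p)"
  define t where "t = inf (sup c p) (sup c q)"
  have cp: "sup c p' = t"
    unfolding p'_def t_def by (rule modularD[OF m]) simp
  have cq: "sup c q' = t"
    unfolding q'_def t_def by (subst modularD[OF m]) (simp_all add: inf_commute)
  have "sup p q' = sup c p"
    unfolding q'_def by (subst modularD[OF m]) (use c(2) in \<open>simp_all add: inf.absorb2\<close>)
  moreover have "q' \<le> sup c q" unfolding q'_def by (simp add: le_infI1 le_supI2)
  then have "sup q' p' = inf (sup q' p) (sup c q)"
    unfolding p'_def by (rule modularD[OF m])
  ultimately have pq: "sup p' q' = t" by (simp add: t_def sup_commute)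
  have dp: "inf c p' = bot" unfolding p'_def using p by (metis inf_assoc inf_bot_left)
  have dq: "inf c q' = bot" unfolding q'_def using q by (metis inf_assoc inf_bot_left)
  have "p' \<noteq> bot"
  proof
    assume "p' = bot"
    with cp cq pq have "sup c q' = c" "q' = c" by simp_all
    with dq c(1) show False by simp
  qed
  moreover have "q' \<noteq> bot"
  proof
    assume "q' = bot"
    with cp cq pq have "sup c p' = c" "p' = c" by simp_all
    with dp c(1) show False by simp
  qed
  ultimately show ?thesis
    using c(1) cp cq pq dp dq unfolding obstructing_triple_def p'_def[symmetric] q'_def[symmetric]
    by auto
qed

lemma disjoint_closed_under_sup:
  fixes p q c :: "'a::bounded_lattice"
  assumes "modular TYPE('a)" and no: "\<not> (\<exists>x y z :: 'a. obstructing_triple x y z)"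
    and "inf c p = bot" and "inf c q = bot"
  shows "inf c (sup p q) = bot"
proof (rule ccontr)
  assume "inf c (sup p q) \<noteq> bot"
  moreover have "inf (inf c (sup p q)) p = bot" "inf (inf c (sup p q)) q = bot"
    using assms(3,4) by (metis inf_assoc inf_commute inf_bot_right)+
  ultimately show False
    using triple_from_disjoint_pair[OF assms(1), of "inf c (sup p q)" p q] no by auto
qed

text \<open>
  Condition (B) on the interval \<open>[0, 1]\<close>, applied to the element \<open>c\<close>, says that a chain of
  elements disjoint from \<open>c\<close> has a join, again disjoint from \<open>c\<close>. This is the hypothesis of Zorn's
  lemma.
\<close>
lemma maximal_disjoint_element:
  fixes c :: "'a::bounded_lattice"
  assumes "condition_B (bot::'a) top"
  shows "\<exists>p. inf c p = bot \<and> (\<forall>x. inf c x = bot \<longrightarrow> p \<le> x \<longrightarrow> x = p)"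
proof -
  let ?A = "{x. inf c x = bot}"
  have "\<exists>p\<in>?A. \<forall>x\<in>?A. p \<le> x \<longrightarrow> x = p"
  proof (rule predicate_Zorn)
    show "partial_order_on ?A (relation_of (\<le>) ?A)"
      by (rule partial_order_on_relation_ofI) auto
  next
    fix C assume C: "C \<in> Chains (relation_of (\<le>) ?A)"
    then have sub: "C \<subseteq> ?A" by (auto simp: Chains_def relation_of_def)
    have "Complete_Partial_Order.chain (\<le>) C"
      using C by (auto simp: Chains_def relation_of_def Complete_Partial_Order.chain_def)
    then obtain s where "isLub {bot..top} C s" "inf c s = bot"
      using assms sub unfolding condition_B_def by (force simp: subset_iff)
    then show "\<exists>u\<in>?A. \<forall>a\<in>C. a \<le> u"
      by (auto simp: isLub_def leastP_def setle_def isUb_def)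
  qed
  then show ?thesis by blast
qed

lemma no_triple_pseudocomplemented:
  assumes "inductive_lattice TYPE('a::bounded_lattice)" and "modular TYPE('a)"
    and "\<not> (\<exists>x y z :: 'a. obstructing_triple x y z)"
  shows "pseudocomplemented TYPE('a)"
  unfolding pseudocomplemented_def
proof
  fix c :: 'a
  have "condition_B (bot::'a) top" using assms(1) by (simp add: inductive_lattice_def)
  then obtain p where p: "inf c p = bot" "\<And>x. inf c x = bot \<Longrightarrow> p \<le> x \<Longrightarrow> x = p"
    using maximal_disjoint_element[of c] by blast
  have "x \<le> p" if "inf c x = bot" for x
    using p(2)[OF disjoint_closed_under_sup[OF assms(2,3) p(1) that]]
    by (metis sup_ge1 sup_ge2)
  with p(1) show "\<exists>p. is_pseudocomplement c p" by (auto simp: is_pseudocomplement_def)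
qed

section \<open>Obstructing triples and forbidden sublattices\<close>

text \<open>
  To find a triple in a 0-sublattice it suffices to locate one in the model lattice. An isomorphism
  onto the sublattice sends the least element of the model to \<open>0\<close>, because \<open>0\<close> is the value of some
  element, which lies above the least one.
\<close>
lemma triple_transfer:
  fixes f :: "'m::lattice \<Rightarrow> 'a::bounded_lattice_bot"
  assumes f: "bij_betw f UNIV S" "\<And>x y. f (sup x y) = sup (f x) (f y)"
      "\<And>x y. f (inf x y) = inf (f x) (f y)"
    and S: "bot \<in> S"
    and z: "\<And>x. z \<le> x"
    and t: "z \<notin> {a, b, c}" "inf c a = z" "inf c b = z" "sup c a = sup c b" "sup c b = sup a b"
  shows "obstructing_triple (f a) (f b) (f c)"
proof -
  from f(1) S obtain y where y: "f y = bot" by (metis bij_betw_imp_surj_on imageE)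
  have "f z = inf (f z) (f y)" using f(3)[of z y] z[of y] by (simp add: inf.absorb1)
  then have z0: "f z = bot" using y by simp
  have inj: "f u = f v \<longleftrightarrow> u = v" for u v
    using f(1) by (metis bij_betw_imp_inj_on inj_eq)
  have "bot \<notin> {f a, f b, f c}" using t(1) inj z0 by (metis insert_iff empty_iff)
  then show ?thesis
    using t(2-5) z0 by (simp add: obstructing_triple_def f(2,3)[symmetric])
qed

lemma M3_triple:
  assumes "zero_sublattice (S :: 'a::bounded_lattice_bot set)" "isomorphic_to S TYPE(M3)"
  shows "\<exists>a b c :: 'a. obstructing_triple a b c"
proof -
  from assms(2) obtain f :: "M3 \<Rightarrow> 'a" where f: "bij_betw f UNIV S"
    "\<And>x y. f (sup x y) = sup (f x) (f y)" "\<And>x y. f (inf x y) = inf (f x) (f y)"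
    unfolding isomorphic_to_def by blast
  have "obstructing_triple (f M3_a) (f M3_b) (f M3_c)"
    by (rule triple_transfer[OF f, of M3_0])
      (use assms(1) in \<open>simp_all add: zero_sublattice_def less_eq_M3_def sup_M3_def inf_M3_def\<close>)
  then show ?thesis by blast
qed

lemma M23_triple:
  assumes "zero_sublattice (S :: 'a::bounded_lattice_bot set)" "isomorphic_to S TYPE(M23)"
  shows "\<exists>a b c :: 'a. obstructing_triple a b c"
proof -
  from assms(2) obtain f :: "M23 \<Rightarrow> 'a" where f: "bij_betw f UNIV S"
    "\<And>x y. f (sup x y) = sup (f x) (f y)" "\<And>x y. f (inf x y) = inf (f x) (f y)"
    unfolding isomorphic_to_def by blast
  have "obstructing_triple (f M23_a) (f M23_b) (f M23_c)"
    by (rule triple_transfer[OF f, of M23_0])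
      (use assms(1) in \<open>simp_all add: zero_sublattice_def less_eq_M23_iff sup_M23_def inf_M23_def
         doubleton_eq_iff\<close>)
  then show ?thesis by blast
qed

lemma range_zero_sublattice:
  fixes f :: "'m::lattice \<Rightarrow> 'a::bounded_lattice_bot"
  assumes "inj f" "\<And>x y. f (sup x y) = sup (f x) (f y)" "\<And>x y. f (inf x y) = inf (f x) (f y)"
    and "f z = bot"
  shows "zero_sublattice (range f)" "isomorphic_to (range f) TYPE('m)"
proof -
  have "bot \<in> range f" using assms(4) by (metis rangeI)
  then show "zero_sublattice (range f)"
    unfolding zero_sublattice_def by (auto simp: assms(2,3)[symmetric])
  show "isomorphic_to (range f) TYPE('m)"
    unfolding isomorphic_to_def using assms(1-3) by (auto simp: bij_betw_def)
qed

text \<open>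
  Besides the triple itself the copies contain \<open>d = a \<sqinter> b\<close>, \<open>e = c \<squnion> d\<close> and the common join \<open>t\<close>.
  Modularity enters only through \<open>a \<sqinter> e = b \<sqinter> e = d\<close>, which makes \<open>a\<close>, \<open>b\<close>, \<open>e\<close> a diamond over
  \<open>d\<close>. For \<open>d = 0\<close> the elements \<open>d\<close> and \<open>e\<close> collapse to \<open>0\<close> and \<open>c\<close>, and \<open>M\<^sub>3\<close> remains.
\<close>
lemma triple_sublattice:
  fixes a b c :: "'a::bounded_lattice"
  assumes m: "modular TYPE('a)" and tr: "obstructing_triple a b c"
  shows "\<exists>S :: 'a set. zero_sublattice S \<and> (isomorphic_to S TYPE(M3) \<or> isomorphic_to S TYPE(M23))"
proof -
  define d where "d = inf a b"
  define e where "e = sup c d"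
  define t where "t = sup a b"
  have nz: "a \<noteq> bot" "b \<noteq> bot" "c \<noteq> bot"
    and ca: "inf c a = bot" "inf c b = bot" and sca: "sup c a = t" "sup c b = t"
    using tr by (auto simp: obstructing_triple_def t_def)
  have le: "a \<le> t" "b \<le> t" "c \<le> t" "d \<le> a" "d \<le> b" "d \<le> e" "c \<le> e"
    using sca by (auto simp: t_def d_def e_def) (metis sup_ge1)
  have le': "d \<le> t" "e \<le> t" using le by (auto simp: e_def intro: order_trans)
  have cd: "inf c d = bot" by (simp add: d_def ca(1) inf_assoc[symmetric])
  have ae: "inf a e = d" "inf b e = d"
    using modularD[OF m le(4), of c] modularD[OF m le(5), of c] ca
    by (simp_all add: e_def inf_commute sup_commute)
  have sae: "sup a e = t" "sup b e = t"
    using sca le(4,5) by (simp_all add: e_def sup.absorb1 sup.left_commute sup.commute sup.assoc)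
      (metis sup.absorb2 sup_commute sup_left_commute)+
  have nc: "\<not> c \<le> a" "\<not> c \<le> b" using nz(3) ca by (auto simp: le_iff_inf)
  \<comment> \<open>If \<open>a\<close> and \<open>b\<close> were comparable, \<open>t\<close> would be one of them, but \<open>c \<le> t\<close> lies below neither.\<close>
  have nab: "d \<noteq> a" "d \<noteq> b" "a \<noteq> t" "b \<noteq> t" "c \<noteq> t"
  proof -
    show at: "a \<noteq> t" and bt: "b \<noteq> t" using nc le(3) by auto
    show "d \<noteq> a" using bt le(5) by (auto simp: t_def sup.absorb2)
    show "d \<noteq> b" using at le(4) by (auto simp: t_def sup.absorb1)
    show "c \<noteq> t" using le(1) ca(1) nz(1) by (auto simp: inf.absorb2)
  qed
  have ab: "a \<noteq> b" "a \<noteq> c" "b \<noteq> c" using nab nz ca by (auto simp: d_def)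
  have tn: "t \<noteq> bot" using le(3) nz(3) by (metis le_bot)
  show ?thesis
  proof (cases "d = bot")
    case True
    define f where "f x = (case x of M3_0 \<Rightarrow> bot | M3_a \<Rightarrow> a | M3_b \<Rightarrow> b | M3_c \<Rightarrow> c | M3_1 \<Rightarrow> t)" for x
    have f: "f M3_0 = bot" "f M3_a = a" "f M3_b = b" "f M3_c = c" "f M3_1 = t"
      by (simp_all add: f_def)
    have inj: "inj f"
      unfolding inj_def
      by (intro allI) (rename_tac x y; case_tac x; case_tac y; use nz ab nab tn in \<open>auto simp: f\<close>)
    have eqs: "inf a b = bot" "inf c a = bot" "inf c b = bot"
      "sup a b = t" "sup c a = t" "sup c b = t"
      using True ca sca by (simp_all add: d_def t_def)
    have eqs': "inf b a = bot" "inf a c = bot" "inf b c = bot"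
      "sup b a = t" "sup a c = t" "sup b c = t"
      using eqs by (simp_all add: inf_commute sup_commute)
    have "f (sup x y) = sup (f x) (f y)" "f (inf x y) = inf (f x) (f y)" for x y
      by (cases x; cases y; simp add: f sup_M3_def inf_M3_def less_eq_M3_def eqs eqs' le
            sup.absorb1 sup.absorb2 inf.absorb1 inf.absorb2)+
    from range_zero_sublattice[OF inj this f(1)] show ?thesis by blast
  next
    case False
    define f where "f x = (case x of M23_0 \<Rightarrow> bot | M23_d \<Rightarrow> d | M23_c \<Rightarrow> c | M23_a \<Rightarrow> a
      | M23_b \<Rightarrow> b | M23_e \<Rightarrow> e | M23_1 \<Rightarrow> t)" for x
    have f: "f M23_0 = bot" "f M23_d = d" "f M23_c = c" "f M23_a = a" "f M23_b = b" "f M23_e = e"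
      "f M23_1 = t" by (simp_all add: f_def)
    have dc: "d \<noteq> c" using cd nz by auto
    have dt: "d \<noteq> t" using nab(1) le(1,4) by auto
    have ed: "e \<noteq> d" using cd le(7) nz by (metis inf.absorb1)
    have ec: "e \<noteq> c" using cd le(6) False by (metis inf.absorb2)
    have ea: "e \<noteq> a" "e \<noteq> b" "e \<noteq> t" "e \<noteq> bot"
      using ae nab le(1,2,6) False by (auto simp: inf.absorb1)
    have inj: "inj f"
      unfolding inj_def
      by (intro allI) (rename_tac x y; case_tac x; case_tac y;
        use nz ab nab tn False dc dt ed ec ea in \<open>auto simp: f\<close>)
    have eqs: "inf a b = d" "inf c a = bot" "inf c b = bot" "inf c d = bot" "inf a e = d" "inf b e = d"
      "sup a b = t" "sup c a = t" "sup c b = t" "sup c d = e" "sup a e = t" "sup b e = t"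
      using ca sca cd ae sae by (simp_all add: d_def[symmetric] t_def[symmetric] e_def[symmetric])
    have eqs': "inf b a = d" "inf a c = bot" "inf b c = bot" "inf d c = bot" "inf e a = d" "inf e b = d"
      "sup b a = t" "sup a c = t" "sup b c = t" "sup d c = e" "sup e a = t" "sup e b = t"
      using eqs by (simp_all add: inf_commute sup_commute)
    have "f (sup x y) = sup (f x) (f y)" "f (inf x y) = inf (f x) (f y)" for x y
      by (cases x; cases y; simp add: f sup_M23_def inf_M23_def less_eq_M23_iff doubleton_eq_iff
            eqs eqs' le le' sup.absorb1 sup.absorb2 inf.absorb1 inf.absorb2)+
    from range_zero_sublattice[OF inj this f(1)] show ?thesis by blast
  qed
qed

section \<open>The equivalence\<close>

theorem theorem2p4:
  assumes "inductive_lattice TYPE('a::bounded_lattice)"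
    and "modular TYPE('a)"
  shows "(pseudocomplemented TYPE('a) \<longleftrightarrow>
            \<not> (\<exists>S :: 'a set. zero_sublattice S \<and>
                 (isomorphic_to S TYPE(M3) \<or> isomorphic_to S TYPE(M23)))) \<and>
         (pseudocomplemented TYPE('a) \<longleftrightarrow>
            \<not> (\<exists>a b c :: 'a. bot \<notin> {a, b, c} \<and>
                 (inf c a = bot \<and> inf c b = bot) \<and>
                 (sup c a = sup c b \<and> sup c b = sup a b)))"
  (is "(_ \<longleftrightarrow> \<not> ?sublattice) \<and> (_ \<longleftrightarrow> \<not> ?triple)")
proof -
  have t: "?triple \<longleftrightarrow> (\<exists>a b c :: 'a. obstructing_triple a b c)"
    by (simp only: obstructing_triple_def)
  have "pseudocomplemented TYPE('a) \<longleftrightarrow> \<not> ?triple"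
    unfolding t using pseudocomplemented_no_triple no_triple_pseudocomplemented[OF assms] by blast
  moreover have "?sublattice \<longleftrightarrow> ?triple"
    unfolding t using M3_triple M23_triple triple_sublattice[OF assms(2)] by blast
  ultimately show ?thesis by blast
qed

end
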